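(* Fix $n\ge1$ and let $M^{(n)}$ be the matrix indexed by pairs of unlabeled binary trees with $n$ nodes with entries $c_{T,U}=\mathrm{Card}\{\sigma\in S_n:\ \mathrm{shape}(\mathrm{bst}(\sigma))=T,\ \mathrm{shape}(\mathrm{bst}(\sigma^{-1}))=U\}$. Say that $T$ and $U$ are in the same block if some power of $M^{(n)}$ has a nonzero $(T,U)$ entry. Then two trees are in the same block if and only if they have the same size and the same skeleton.
   Context: A binary tree is empty or a node with left and right subtrees. For a word $w$, $\mathrm{bst}(w)$ is obtained by reading $w$ right to left and inserting each letter $x$: into an empty tree create a node labeled $x$; otherwise insert recursively into the left subtree if $x\le$ root label, into the right subtree if $x>$ root label; shape denotes the underlying unlabeled tree. For an unlabeled tree $T$ with $n$ nodes, $w_T\in S_n$ is the right-to-left postfix reading (right subtree, left subtree, root, recursively) of the unique labeling of $T$ by $1,\dots,n$ with each label greater than those of its left subtree and smaller than those of its right subtree. The saillances of a word $\tau$ of distinct integers are the letters $i$ of $\tau$ such that all letters to the right of $i$ in $\tau$ are smaller than $i$. The skeleton of a tree $T$ with $n$ nodes is the pair $(k,l)$ where $k\le n-1$ is the greatest integer such that $w_T(n)=n,\ w_T(n-1)=n-1,\dots,w_T(n-k+1)=n-k+1$, and $l$ is the number of saillances of the word obtained from $w_T$ by removing its last $k$ letters. *)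

theory Defs
  imports "HOL-Library.Tree" "HOL-Combinatorics.Permutations"
begin

text \<open>Unlabeled binary trees are rendered as \<open>unit tree\<close>.\<close>

definition shape :: "'a tree \<Rightarrow> unit tree" where
  "shape t = map_tree (\<lambda>_. ()) t"

definition trees :: "nat \<Rightarrow> unit tree set" where
  "trees n = {T. size T = n}"

fun bst_insert :: "'a::linorder \<Rightarrow> 'a tree \<Rightarrow> 'a tree" where
  "bst_insert x Leaf = Node Leaf x Leaf"
| "bst_insert x (Node l a r) =
     (if x \<le> a then Node (bst_insert x l) a r else Node l a (bst_insert x r))"

text \<open>\<open>foldr\<close> inserts the last letter of the word first. The library predicate \<open>bst\<close>
  is a different notion (the strict search-tree property).\<close>

definition bst_of_word :: "'a::linorder list \<Rightarrow> 'a tree" where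
  "bst_of_word w = foldr bst_insert w Leaf"

definition word_of_perm :: "nat \<Rightarrow> (nat \<Rightarrow> nat) \<Rightarrow> nat list" where
  "word_of_perm n \<sigma> = map \<sigma> [1..<Suc n]"

definition standard_labeling :: "unit tree \<Rightarrow> nat tree" where
  "standard_labeling T = (THE t. shape t = T \<and> set_tree t = {1..size T} \<and> bst t)"

fun rl_postfix :: "'a tree \<Rightarrow> 'a list" where
  "rl_postfix Leaf = []"
| "rl_postfix (Node l a r) = rl_postfix r @ rl_postfix l @ [a]"

definition tree_word :: "unit tree \<Rightarrow> nat list" where
  "tree_word T = rl_postfix (standard_labeling T)"

definition saillances :: "'a::linorder list \<Rightarrow> 'a set" where
  "saillances \<tau> = {\<tau> ! i | i. i < length \<tau> \<and> (\<forall>j. i < j \<and> j < length \<tau> \<longrightarrow> \<tau> ! j < \<tau> ! i)}"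

text \<open>The letter \<open>w\<^sub>T(i)\<close>, for \<open>1 \<le> i \<le> n\<close>, is \<open>tree_word T ! (i - 1)\<close>.\<close>

definition skeleton_fst :: "unit tree \<Rightarrow> nat" where
  "skeleton_fst T = (GREATEST k. k \<le> size T - 1 \<and>
     (\<forall>i\<in>{size T - k + 1..size T}. tree_word T ! (i - 1) = i))"

definition skeleton :: "unit tree \<Rightarrow> nat \<times> nat" where
  "skeleton T = (skeleton_fst T,
     card (saillances (take (size T - skeleton_fst T) (tree_word T))))"

definition M :: "nat \<Rightarrow> unit tree \<Rightarrow> unit tree \<Rightarrow> nat" where
  "M n T U = card {\<sigma>. \<sigma> permutes {1..n} \<and>
     shape (bst_of_word (word_of_perm n \<sigma>)) = T \<and>
     shape (bst_of_word (word_of_perm n (inv \<sigma>))) = U}"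

text \<open>Powers of a square matrix with rows and columns indexed by a finite set \<open>I\<close>.\<close>

primrec matrix_power ::
  "'i set \<Rightarrow> ('i \<Rightarrow> 'i \<Rightarrow> 'a::comm_semiring_1) \<Rightarrow> nat \<Rightarrow> 'i \<Rightarrow> 'i \<Rightarrow> 'a" where
  "matrix_power I A 0 = (\<lambda>x y. if x = y then 1 else 0)"
| "matrix_power I A (Suc k) = (\<lambda>x y. \<Sum>z\<in>I. matrix_power I A k x z * A z y)"

text \<open>Excluding the zeroth power does not change the relation: the matrix is symmetric
  without zero rows, so the diagonal entries of its square are nonzero.\<close>

definition same_block :: "nat \<Rightarrow> unit tree \<Rightarrow> unit tree \<Rightarrow> bool" where
  "same_block n T U \<longleftrightarrow> (\<exists>k\<ge>1. matrix_power (trees n) (M n) k T U \<noteq> 0)"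

text \<open>Well-definedness of the sums over \<open>trees n\<close> and of the labeling.\<close>

lemma finite_trees: "finite (trees n)"
proof (induction n rule: less_induct)
  case (less n)
  have "trees n \<subseteq> insert Leaf
    ((\<lambda>(l, r). Node l () r) ` ((\<Union>m<n. trees m) \<times> (\<Union>m<n. trees m)))" (is "_ \<subseteq> ?B")
  proof
    fix T assume "T \<in> trees n"
    then show "T \<in> ?B"
      by (cases T) (auto simp: trees_def image_iff)
  qed
  moreover have "finite ?B" using less by auto
  ultimately show ?case by (rule finite_subset)
qed

lemma ex1_shape_inorder:
  "length xs = size T \<Longrightarrow> \<exists>!t. shape t = T \<and> inorder t = xs"
proof (induction T arbitrary: xs)
  case Leaf
  then show ?case by (auto simp: shape_def)
next
  case (Node L u R)
  have len: "size t = size V" if "shape t = V" for t :: "'a tree" and V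
    using that by (auto simp: shape_def)
  obtain ys x zs where xs: "xs = ys @ x # zs" "length ys = size L" "length zs = size R"
    using Node.prems id_take_nth_drop[of "size L" xs] by (auto simp: min_def)
  obtain l where l: "shape l = L" "inorder l = ys" using Node.IH(1) xs by blast
  obtain r where r: "shape r = R" "inorder r = zs" using Node.IH(2) xs by blast
  show ?case
  proof (rule ex1I[of _ "Node l x r"])
    show "shape (Node l x r) = Node L u R \<and> inorder (Node l x r) = xs"
      using l r xs by (simp add: shape_def)
  next
    fix t assume t: "shape t = Node L u R \<and> inorder t = xs"
    then obtain l' x' r' where t': "t = Node l' x' r'" "shape l' = L" "shape r' = R"
      by (cases t) (auto simp: shape_def)
    then have "inorder l' @ x' # inorder r' = ys @ x # zs" "length (inorder l') = length ys"
      using t xs len[OF t'(2)] by auto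
    then have "inorder l' = ys" "x' = x" "inorder r' = zs" by auto
    then show "t = Node l x r"
      using t' l r Node.IH(1)[of ys] Node.IH(2)[of zs] xs by blast
  qed
qed

lemma standard_labeling_ex1:
  "\<exists>!t::nat tree. shape t = T \<and> set_tree t = {1..size T} \<and> bst t"
proof -
  let ?xs = "[1..<Suc (size T)]"
  have xs: "sorted_wrt (<) ?xs" "set ?xs = {1..size T}"
    by (simp only: sorted_wrt_upt, simp only: set_upt atLeastLessThanSuc_atLeastAtMost)
  have *: "(set_tree t = {1..size T} \<and> bst t) = (inorder t = ?xs)" for t :: "nat tree"
    using xs strict_sorted_equal[of "inorder t" ?xs]
    by (metis bst_iff_sorted_wrt_less set_inorder)
  have "\<exists>!t. shape t = T \<and> inorder t = ?xs"
    by (rule ex1_shape_inorder) (simp only: length_upt)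
  then show ?thesis by (simp only: *)
qed

end

theory Submission
  imports Defs
begin

text \<open>
  The shape of \<open>bst(\<sigma>\<inverse>)\<close> is the shape of the decreasing tree of the word \<open>\<sigma>\<close>, so two trees are linked
  by a nonzero entry iff they are the search tree and the decreasing tree of a common word.
  The integer \<open>k\<close> of the skeleton counts how often one can remove a root without right child but with a
  left child, and \<open>l\<close> is the length of the right spine of the remaining tree.  Both trees of a word lose their root in
  this way iff the last letter is the maximum, and both right spines have as many nodes as the
  word has saillances; hence the skeleton is an invariant.

  Conversely, appending a maximal letter reduces to \<open>k = 0\<close>.  Reading all nodes off the right spine
  first links a tree to one whose right subtree is a right comb and whose left subtree is the
  decreasing tree of some word \<open>u\<close>.  If \<open>l \<ge> 2\<close>, exchanging two adjacent letters of \<open>u\<close> does not change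
  the component: complete \<open>u\<close> by a decreasing word of saillances ending in a letter \<open>c\<close> between the two
  letters; then \<open>c\<close> is the root of the search tree and separates them.  So \<open>u\<close> may be sorted.
\<close>

section \<open>Binary search trees of words\<close>

lemma shape_simps [simp]:
  "shape Leaf = Leaf" "shape (Node l a r) = Node (shape l) () (shape r)"
  by (simp_all add: shape_def)

lemma size_shape [simp]: "size (shape t) = size t"
  by (simp add: shape_def)

lemma shape_eq_Leaf_iff [simp]: "shape t = Leaf \<longleftrightarrow> t = Leaf"
  by (cases t) simp_all

text \<open>Insertion leaves the root in place, so each letter is routed by one comparison with
  \<open>a\<close>, and the two subtrees grow independently.\<close>

lemma foldr_bst_insert_Node:
  "foldr bst_insert w (Node l a r) =
     Node (foldr bst_insert (filter (\<lambda>x. x \<le> a) w) l) a (foldr bst_insert (filter (\<lambda>x. a < x) w) r)"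
  by (induction w) auto

lemma filter_separated:
  "\<forall>x\<in>set xs. x \<le> a \<Longrightarrow> filter (\<lambda>x. x \<le> a) xs = xs"
  "\<forall>x\<in>set xs. x \<le> a \<Longrightarrow> filter (\<lambda>x. a < x) xs = []"
  "\<forall>x\<in>set xs. a < x \<Longrightarrow> filter (\<lambda>x. x \<le> a) xs = []"
  "\<forall>x\<in>set xs. a < x \<Longrightarrow> filter (\<lambda>x. a < x) xs = xs"
  for a :: "'a::linorder"
  by (induction xs) auto

lemma bst_of_word_Nil [simp]: "bst_of_word [] = Leaf"
  by (simp add: bst_of_word_def)

lemma bst_of_word_snoc:
  "bst_of_word (w @ [a]) =
     Node (bst_of_word (filter (\<lambda>x. x \<le> a) w)) a (bst_of_word (filter (\<lambda>x. a < x) w))"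
  by (simp add: bst_of_word_def foldr_bst_insert_Node)

text \<open>The last letter \<open>c\<close> is inserted first and becomes the root, so
  \<open>u\<close> enters only through its letters on each side of \<open>c\<close>.\<close>

lemma bst_of_word_append_cong:
  assumes "filter (\<lambda>x. x \<le> c) u = filter (\<lambda>x. x \<le> c) u'"
    and "filter (\<lambda>x. c < x) u = filter (\<lambda>x. c < x) u'"
  shows "bst_of_word (u @ s @ [c]) = bst_of_word (u' @ s @ [c])"
  using assms bst_of_word_snoc[of "u @ s" c] bst_of_word_snoc[of "u' @ s" c] by simp

lemma size_bst_of_word [simp]: "size (bst_of_word w) = length w"
proof -
  have "size (bst_insert x t) = Suc (size t)" for x and t :: "'a tree"
    by (induction t) auto
  then show ?thesis by (induction w) (auto simp: bst_of_word_def)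
qed

lemma shape_bst_of_word_map:
  fixes h :: "'a::linorder \<Rightarrow> 'b::linorder"
  assumes "strict_mono_on (set w) h"
  shows "shape (bst_of_word (map h w)) = shape (bst_of_word w)"
  using assms
proof (induction "length w" arbitrary: w rule: less_induct)
  case less
  show ?case
  proof (cases w rule: rev_cases)
    case (snoc v a)
    have le: "h x \<le> h a \<longleftrightarrow> x \<le> a" if "x \<in> set v" for x
      using less.prems that snoc strict_mono_on_less_eq[of "set w" h x a] by simp
    have "filter (\<lambda>x. x \<le> h a) (map h v) = map h (filter (\<lambda>x. x \<le> a) v)"
      "filter (\<lambda>x. h a < x) (map h v) = map h (filter (\<lambda>x. a < x) v)"
      by (auto simp: filter_map le not_le[symmetric] intro!: arg_cong[of _ _ "map h"] filter_cong)
    moreover have "strict_mono_on (set (filter P v)) h" for P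
      using less.prems snoc by (auto intro: monotone_on_subset)
    ultimately show ?thesis
      using less.hyps[of "filter (\<lambda>x. x \<le> a) v"] less.hyps[of "filter (\<lambda>x. a < x) v"]
      by (simp add: snoc bst_of_word_snoc le_imp_less_Suc)
  qed simp
qed

section \<open>Postfix readings of search trees\<close>

lemma set_rl_postfix [simp]: "set (rl_postfix t) = set_tree t"
  by (induction t) auto

lemma length_rl_postfix [simp]: "length (rl_postfix t) = size t"
  by (induction t) auto

lemma rl_postfix_map_tree: "rl_postfix (map_tree h t) = map h (rl_postfix t)"
  by (induction t) auto

lemma distinct_rl_postfix: "bst t \<Longrightarrow> distinct (rl_postfix (t :: 'a::linorder tree))"
  by (induction t) fastforce+

text \<open>The root is read last, hence inserted first; it then separates the readings of its two
  subtrees.\<close>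

lemma bst_of_word_rl_postfix: "bst t \<Longrightarrow> bst_of_word (rl_postfix t) = (t :: 'a::linorder tree)"
proof (induction t)
  case (Node l a r)
  have "filter (\<lambda>x. x \<le> a) (rl_postfix r @ rl_postfix l) = rl_postfix l"
    "filter (\<lambda>x. a < x) (rl_postfix r @ rl_postfix l) = rl_postfix r"
    using Node.prems by (simp_all add: filter_separated less_imp_le)
  then show ?case
    using Node bst_of_word_snoc[of "rl_postfix r @ rl_postfix l" a] by simp
qed simp

section \<open>Decreasing trees of words\<close>

text \<open>Labels are dropped, since only the shape is compared with other trees.\<close>

function dtree :: "'a::linorder list \<Rightarrow> unit tree" where
  "dtree w = (if w = [] then Leaf else
     Node (dtree (takeWhile (\<lambda>x. x \<noteq> Max (set w)) w)) ()
          (dtree (tl (dropWhile (\<lambda>x. x \<noteq> Max (set w)) w))))"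
  by pat_completeness auto
termination
proof (relation "measure length")
  fix w :: "'a list" assume w: "w \<noteq> []"
  then have "Max (set w) \<in> set w" by simp
  then have "takeWhile (\<lambda>x. x \<noteq> Max (set w)) w \<noteq> w"
    unfolding takeWhile_eq_all_conv by blast
  then have "length (takeWhile (\<lambda>x. x \<noteq> Max (set w)) w) \<noteq> length w"
    by (metis takeWhile_eq_take take_all order_refl)
  then have "length (takeWhile (\<lambda>x. x \<noteq> Max (set w)) w) < length w"
    using length_takeWhile_le[of "\<lambda>x. x \<noteq> Max (set w)" w] by linarith
  then show "(takeWhile (\<lambda>x. x \<noteq> Max (set w)) w, w) \<in> measure length" by simp
  have "length (dropWhile (\<lambda>x. x \<noteq> Max (set w)) w) \<le> length w"
    by (rule length_dropWhile_le)
  then show "(tl (dropWhile (\<lambda>x. x \<noteq> Max (set w)) w), w) \<in> measure length"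
    using w by (cases w) (auto simp: less_Suc_eq_le)
qed auto

declare dtree.simps [simp del]

lemma dtree_Nil [simp]: "dtree [] = Leaf"
  by (simp add: dtree.simps)

lemma dtree_append:
  assumes "\<forall>x\<in>set xs \<union> set ys. x < a"
  shows "dtree (xs @ a # ys) = Node (dtree xs) () (dtree ys)"
proof -
  have "Max (set (xs @ a # ys)) = a"
    using assms by (intro Max_eqI) (auto intro: less_imp_le)
  moreover have "takeWhile (\<lambda>x. x \<noteq> a) (xs @ a # ys) = xs"
    "dropWhile (\<lambda>x. x \<noteq> a) (xs @ a # ys) = a # ys"
    using assms by (subst takeWhile_append2 dropWhile_append2; fastforce)+
  ultimately show ?thesis by (simp add: dtree.simps[of "xs @ a # ys"])
qed

text \<open>Induction along the decreasing tree: the word is cut at its maximum, so that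
  \<open>dtree_append\<close> applies in the inductive step.\<close>

lemma distinct_max_induct [consumes 1, case_names Nil Max]:
  assumes "distinct w" and "P []"
    and "\<And>xs a ys. \<lbrakk>distinct (xs @ a # ys); \<forall>x\<in>set xs \<union> set ys. x < (a :: 'a::linorder);
           P xs; P ys\<rbrakk> \<Longrightarrow> P (xs @ a # ys)"
  shows "P w"
  using assms(1)
proof (induction "length w" arbitrary: w rule: less_induct)
  case less
  show ?case
  proof (cases "w = []")
    case False
    then have "Max (set w) \<in> set w" by simp
    then obtain xs ys where w: "w = xs @ Max (set w) # ys"
      by (meson split_list)
    define a where "a = Max (set w)"
    have w': "w = xs @ a # ys" using w a_def by simp
    have "x < a" if "x \<in> set xs \<union> set ys" for x
    proof -
      have "x \<le> a" unfolding a_def by (rule Max_ge) (use that in \<open>auto simp: w'\<close>)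
      moreover have "x \<noteq> a" using that less.prems w' by auto
      ultimately show ?thesis by simp
    qed
    then show ?thesis
      using assms(3)[of xs a ys] less.hyps[of xs] less.hyps[of ys] less.prems w' by auto
  qed (simp add: assms(2))
qed

lemma dtree_map:
  assumes "distinct w" "strict_mono_on (set w) h"
  shows "dtree (map h w) = dtree w"
  using assms
proof (induction w rule: distinct_max_induct)
  case (Max xs a ys)
  have "strict_mono_on (set xs) h" "strict_mono_on (set ys) h"
    using Max.prems by (auto intro: monotone_on_subset)
  moreover have "h x < h a" if "x \<in> set xs \<union> set ys" for x
    using Max.hyps(2) that strict_mono_onD[OF Max.prems, of x a] that by auto
  ultimately show ?case
    using Max.IH Max.hyps(2) dtree_append[of "map h xs" "map h ys" "h a"] dtree_append[of xs ys a]
    by auto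
qed simp

lemma size_dtree: "distinct w \<Longrightarrow> size (dtree w) = length w"
  by (induction w rule: distinct_max_induct) (simp_all add: dtree_append)

text \<open>Reading the positions by increasing value is passing to the inverse permutation.\<close>

lemma shape_bst_of_positions:
  fixes g :: "'a::linorder \<Rightarrow> 'b::linorder"
  assumes "sorted_wrt (\<lambda>x y. g x < g y) xs"
  shows "shape (bst_of_word xs) = dtree (map g (sort xs))"
  using assms
proof (induction "length xs" arbitrary: xs rule: less_induct)
  case less
  show ?case
  proof (cases xs rule: rev_cases)
    case (snoc ys p)
    let ?l = "filter (\<lambda>x. x \<le> p) ys" and ?r = "filter (\<lambda>x. p < x) ys"
    \<comment> \<open>The last entry \<open>p\<close> is the root of the search tree, and its value
      under \<open>g\<close> is the maximum, hence the root of the decreasing tree.\<close>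
    have lt: "g x < g p" if "x \<in> set ys" for x
      using less.prems that by (auto simp: snoc sorted_wrt_append)
    have s: "sorted_wrt (\<lambda>x y. g x < g y) (filter P ys)" for P
      using less.prems by (auto simp: snoc sorted_wrt_append intro: sorted_wrt_filter)
    have "mset (filter (\<lambda>x. x \<le> p) ys) + mset (filter (\<lambda>x. p < x) ys) = mset ys"
      by (simp add: not_le[symmetric])
    then have "mset (sort ?l @ p # sort ?r) = mset xs"
      by (simp add: snoc)
    moreover have "sorted (sort ?l @ p # sort ?r)"
      by (auto simp: sorted_append)
    ultimately have "sort xs = sort ?l @ p # sort ?r"
      by (metis properties_for_sort)
    moreover have "dtree (map g (sort ?l) @ g p # map g (sort ?r)) =
        Node (dtree (map g (sort ?l))) () (dtree (map g (sort ?r)))"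
      by (rule dtree_append) (use lt in auto)
    moreover have "shape (bst_of_word ?l) = dtree (map g (sort ?l))"
      "shape (bst_of_word ?r) = dtree (map g (sort ?r))"
      using s by (intro less.hyps; simp add: snoc le_imp_less_Suc)+
    ultimately show ?thesis
      by (simp only: snoc bst_of_word_snoc shape_simps map_append list.map)
  qed simp
qed

section \<open>Nonzero entries of the matrix\<close>

text \<open>Letters are arbitrary naturals, so words can be extended and spread out without
  renumbering.\<close>

definition linked :: "unit tree \<Rightarrow> unit tree \<Rightarrow> bool" where
  "linked T U \<longleftrightarrow>
     (\<exists>w :: nat list. distinct w \<and> T = shape (bst_of_word w) \<and> U = dtree w)"

lemma linkedI:
  "distinct (w :: nat list) \<Longrightarrow> linked (shape (bst_of_word w)) (dtree w)"
  unfolding linked_def by blast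

lemma linked_size: "linked T U \<Longrightarrow> size T = size U"
  by (auto simp: linked_def size_dtree)

text \<open>Along the word of \<open>inv \<sigma>\<close> the values of \<open>\<sigma>\<close>
  increase, and sorting that word gives \<open>1, ..., n\<close>; so
  \<open>shape_bst_of_positions\<close> applies with \<open>\<sigma>\<close> as
  \<open>g\<close>.\<close>

lemma shape_bst_of_inverse:
  assumes "\<sigma> permutes {1..n}"
  shows "shape (bst_of_word (word_of_perm n (inv \<sigma>))) = dtree (word_of_perm n \<sigma>)"
proof -
  have \<sigma>: "\<sigma> (inv \<sigma> x) = x" for x
    using assms by (rule permutes_inverses)
  let ?w = "map (inv \<sigma>) [1..<Suc n]"
  have "sorted_wrt (\<lambda>x y. \<sigma> x < \<sigma> y) ?w"
    by (simp only: sorted_wrt_map \<sigma> sorted_wrt_upt)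
  then have "shape (bst_of_word ?w) = dtree (map \<sigma> (sort ?w))"
    by (rule shape_bst_of_positions)
  moreover have "sort ?w = [1..<Suc n]"
  proof -
    have "inj (inv \<sigma>)" using permutes_inj[OF permutes_inv[OF assms]] .
    then have "distinct ?w" by (simp only: distinct_map distinct_upt inj_on_subset[OF _ subset_UNIV])
    then have "sort ?w = sorted_list_of_set (set ?w)"
      by (simp only: sorted_list_of_set_sort_remdups distinct_remdups_id)
    also have "set ?w = {1..<Suc n}"
      using permutes_image[OF permutes_inv[OF assms]]
      by (simp only: set_map set_upt atLeastLessThanSuc_atLeastAtMost)
    finally show ?thesis by (simp only: sorted_list_of_set_range)
  qed
  ultimately show ?thesis by (simp only: word_of_perm_def)
qed

lemma finite_M_set: "finite {\<sigma>. \<sigma> permutes {1..n} \<and> P \<sigma>}" for n :: nat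
  by (rule finite_subset[OF _ finite_permutations[OF finite_atLeastAtMost]]) blast

lemma M_nonzero_iff:
  "M n T U \<noteq> 0 \<longleftrightarrow> (\<exists>\<sigma>. \<sigma> permutes {1..n} \<and>
     shape (bst_of_word (word_of_perm n \<sigma>)) = T \<and>
     shape (bst_of_word (word_of_perm n (inv \<sigma>))) = U)"
  unfolding M_def card_0_eq[OF finite_M_set] by blast

lemma M_nonzero_iff_word:
  "M n T U \<noteq> 0 \<longleftrightarrow>
     (\<exists>w. distinct w \<and> set w = {1..n} \<and> T = shape (bst_of_word w) \<and> U = dtree w)"
proof
  assume "M n T U \<noteq> 0"
  then obtain \<sigma> where \<sigma>: "\<sigma> permutes {1..n}" "shape (bst_of_word (word_of_perm n \<sigma>)) = T"
     "shape (bst_of_word (word_of_perm n (inv \<sigma>))) = U"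
    by (auto simp only: M_nonzero_iff)
  moreover have "distinct (word_of_perm n \<sigma>)"
    using permutes_inj_on[OF \<sigma>(1)] by (simp only: word_of_perm_def distinct_map distinct_upt)
  moreover have "set (word_of_perm n \<sigma>) = {1..n}"
    using permutes_image[OF \<sigma>(1)]
    by (simp only: word_of_perm_def set_map set_upt atLeastLessThanSuc_atLeastAtMost)
  ultimately show "\<exists>w. distinct w \<and> set w = {1..n} \<and> T = shape (bst_of_word w) \<and> U = dtree w"
    using shape_bst_of_inverse by metis
next
  assume "\<exists>w. distinct w \<and> set w = {1..n} \<and> T = shape (bst_of_word w) \<and> U = dtree w"
  then obtain w where w: "distinct w" "set w = {1..n}" "T = shape (bst_of_word w)" "U = dtree w"
    by blast
  then have len: "length w = n"
    using distinct_card[of w] by simp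
  \<comment> \<open>List positions start at 0; outside \<open>{1..n}\<close> the identity is
    required by \<open>permutes\<close>.\<close>
  define \<sigma> where "\<sigma> = (\<lambda>i. if i \<in> {1..n} then w ! (i - 1) else i)"
  have "map \<sigma> [1..<Suc n] = w"
    by (rule nth_equalityI) (auto simp: len \<sigma>_def simp del: upt_Suc)
  then have word: "word_of_perm n \<sigma> = w" by (simp add: word_of_perm_def del: upt_Suc)
  have "inj_on \<sigma> {1..n}"
    unfolding inj_on_def \<sigma>_def using w(1) len by (auto simp: nth_eq_iff_index_eq)
  moreover have "\<sigma> ` {1..n} = {1..n}"
    using word w(2) by (metis word_of_perm_def set_map set_upt atLeastLessThanSuc_atLeastAtMost)
  ultimately have "\<sigma> permutes {1..n}"
    by (intro bij_imp_permutes) (auto simp: bij_betw_def \<sigma>_def)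
  then show "M n T U \<noteq> 0"
    using w shape_bst_of_inverse[of \<sigma> n] word by (auto simp only: M_nonzero_iff)
qed

text \<open>Replacing each letter by its rank \<open>h\<close> preserves all comparisons, hence both
  trees, and turns the word into a permutation of \<open>1, ..., n\<close>.\<close>

lemma M_nonzero_iff_linked: "M n T U \<noteq> 0 \<longleftrightarrow> linked T U \<and> size T = n"
proof
  assume "M n T U \<noteq> 0"
  then show "linked T U \<and> size T = n"
    unfolding M_nonzero_iff_word linked_def using distinct_card by fastforce
next
  assume "linked T U \<and> size T = n"
  then obtain w :: "nat list" where
    w: "distinct w" "T = shape (bst_of_word w)" "U = dtree w" "length w = n"
    by (auto simp: linked_def)
  define h where "h x = card {y \<in> set w. y \<le> x}" for x
  have "h x < h y" if "x \<in> set w" "y \<in> set w" "x < y" for x y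
  proof -
    have "{z \<in> set w. z \<le> x} \<subseteq> {z \<in> set w. z \<le> y}" using that by auto
    moreover have "y \<in> {z \<in> set w. z \<le> y}" "y \<notin> {z \<in> set w. z \<le> x}" using that by auto
    ultimately have "{z \<in> set w. z \<le> x} \<subset> {z \<in> set w. z \<le> y}" by blast
    then show ?thesis unfolding h_def by (intro psubset_card_mono) auto
  qed
  then have mono: "strict_mono_on (set w) h"
    by (auto intro: strict_mono_onI)
  then have inj: "inj_on h (set w)"
    by (rule strict_mono_on_imp_inj_on)
  have "card (h ` set w) = n"
    using inj w by (simp add: card_image distinct_card)
  moreover have "h ` set w \<subseteq> {1..n}"
  proof
    fix z assume "z \<in> h ` set w"
    then obtain x where x: "x \<in> set w" "z = h x" by auto
    have "{y \<in> set w. y \<le> x} \<noteq> {}" using x by auto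
    then have "h x > 0" unfolding h_def by (simp add: card_gt_0_iff)
    moreover have "h x \<le> card (set w)" unfolding h_def by (intro card_mono) auto
    ultimately show "z \<in> {1..n}" using x w by (simp add: distinct_card)
  qed
  ultimately have "set (map h w) = {1..n}"
    by (simp add: card_subset_eq)
  moreover have "distinct (map h w)" using inj w by (simp add: distinct_map)
  moreover have "T = shape (bst_of_word (map h w))" "U = dtree (map h w)"
    using w mono by (simp_all add: shape_bst_of_word_map dtree_map)
  ultimately show "M n T U \<noteq> 0"
    unfolding M_nonzero_iff_word by blast
qed

lemma M_nonzero_sym: "M n T U \<noteq> 0 \<Longrightarrow> M n U T \<noteq> 0"
  unfolding M_nonzero_iff by (metis permutes_inv permutes_inv_inv)

text \<open>The symmetry is not visible on words; it comes from exchanging a permutation with its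
  inverse.\<close>

lemma linked_sym: "linked T U \<Longrightarrow> linked U T"
  using M_nonzero_sym[of "size T" T U] by (simp only: M_nonzero_iff_linked)

section \<open>Skeletons\<close>

fun rspine :: "'a tree \<Rightarrow> nat" where
  "rspine Leaf = 0"
| "rspine (Node l a r) = Suc (rspine r)"

lemma rspine_shape [simp]: "rspine (shape t) = rspine t"
  by (induction t) auto

lemma saillances_Nil [simp]: "saillances [] = {}"
  by (simp add: saillances_def)

lemma saillances_Cons:
  "saillances (x # xs) = (if \<forall>y\<in>set xs. y < x then {x} else {}) \<union> saillances xs" (is "?L = ?R")
proof (rule set_eqI)
  fix z
  have "z \<in> ?L \<longleftrightarrow> (\<exists>i<Suc (length xs). z = (x # xs) ! i \<and>
      (\<forall>j<Suc (length xs). i < j \<longrightarrow> (x # xs) ! j < (x # xs) ! i))"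
    by (auto simp: saillances_def)
  also have "\<dots> \<longleftrightarrow> z \<in> ?R"
    by (auto simp: Ex_less_Suc2 All_less_Suc2 saillances_def all_set_conv_all_nth)
  finally show "z \<in> ?L \<longleftrightarrow> z \<in> ?R" .
qed

lemma saillances_subset: "saillances xs \<subseteq> set xs"
  by (auto simp: saillances_def)

text \<open>A letter before \<open>a\<close> can be a saillance only if it exceeds \<open>a\<close>,
  and letters up to \<open>a\<close> cannot block it. The filter is the one that builds the right
  subtree in \<open>bst_of_word_snoc\<close>.\<close>

lemma saillances_snoc:
  "saillances (xs @ [a]) = insert a (saillances (filter (\<lambda>x. a < x) xs))"
proof (induction xs)
  case (Cons x xs)
  have "(\<forall>y\<in>set (xs @ [a]). y < x) \<longleftrightarrow> a < x \<and> (\<forall>y\<in>set (filter (\<lambda>x. a < x) xs). y < x)"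
    by (auto simp: not_less)
  then show ?case using Cons by (simp add: saillances_Cons)
qed (simp add: saillances_Cons)

lemma saillances_append_max:
  assumes "\<forall>x\<in>set xs. x < a"
  shows "saillances (xs @ a # ys) = saillances (a # ys)"
  using assms
proof (induction xs)
  case (Cons x xs)
  then have "\<not> (\<forall>y\<in>set (xs @ a # ys). y < x)" by auto
  then have "saillances (x # xs @ a # ys) = saillances (xs @ a # ys)"
    unfolding saillances_Cons[of x] by (simp only: if_False Un_empty_left)
  then show ?case using Cons by simp
qed simp

lemma finite_saillances [simp]: "finite (saillances xs)"
  by (rule finite_subset[OF saillances_subset]) simp

lemma rspine_bst_of_word: "rspine (bst_of_word w) = card (saillances w)"
proof (induction "length w" arbitrary: w rule: less_induct)
  case less
  show ?case
  proof (cases w rule: rev_cases)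
    case (snoc v a)
    have "a \<notin> saillances (filter (\<lambda>x. a < x) v)"
      using saillances_subset by fastforce
    then show ?thesis
      using less[of "filter (\<lambda>x. a < x) v"]
      by (simp add: snoc bst_of_word_snoc saillances_snoc le_imp_less_Suc)
  qed simp
qed

text \<open>The maximum is a saillance that hides every letter before it; the letters after it form
  the right subtree.\<close>

lemma rspine_dtree: "distinct w \<Longrightarrow> rspine (dtree w) = card (saillances w)"
proof (induction w rule: distinct_max_induct)
  case (Max xs a ys)
  have "a \<notin> saillances ys"
    using saillances_subset[of ys] Max.hyps(2) by fastforce
  then show ?case
    using Max by (simp add: dtree_append saillances_append_max saillances_Cons)
qed simp

section \<open>Recursion for tree words and skeletons\<close>

lemma standard_labeling:
  "shape (standard_labeling T) = T" "set_tree (standard_labeling T) = {1..size T}"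
  "bst (standard_labeling T)"
  using theI'[OF standard_labeling_ex1[of T]] by (simp_all add: standard_labeling_def)

lemma standard_labeling_eqI:
  assumes "shape t = T" "set_tree t = {1..size T}" "bst t"
  shows "standard_labeling T = t"
  unfolding standard_labeling_def using assms by (intro the1_equality[OF standard_labeling_ex1]) simp

text \<open>The left subtree takes the labels up to \<open>size l\<close>, the root the next one,
  and the right subtree is shifted past both.\<close>

lemma tree_word_simps:
  "tree_word Leaf = []"
  "tree_word (Node l () r) =
     map (\<lambda>x. x + (size l + 1)) (tree_word r) @ tree_word l @ [size l + 1]"
proof -
  have "standard_labeling Leaf = Leaf"
    by (rule standard_labeling_eqI) simp_all
  then show "tree_word Leaf = []" by (simp add: tree_word_def)
  let ?r = "map_tree (\<lambda>x. x + (size l + 1)) (standard_labeling r)"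
  have "standard_labeling (Node l () r) = Node (standard_labeling l) (size l + 1) ?r"
  proof (rule standard_labeling_eqI)
    show "shape (Node (standard_labeling l) (size l + 1) ?r) = Node l () r"
      using standard_labeling(1)[of l] standard_labeling(1)[of r]
      by (simp add: shape_def tree.map_comp comp_def)
    have "(\<lambda>x. x + (size l + 1)) ` {1..size r} = {size l + 2..size l + size r + 1}"
      by (simp only: image_add_atLeastAtMost') (simp add: ac_simps)
    then show "set_tree (Node (standard_labeling l) (size l + 1) ?r) = {1..size (Node l () r)}"
      by (auto simp: tree.set_map standard_labeling)
    have "bst (map_tree (\<lambda>x. x + c) t)" if "bst t" for c and t :: "nat tree"
      using that by (induction t) (auto simp: tree.set_map)
    then have "bst ?r" by (simp only: standard_labeling)
    then show "bst (Node (standard_labeling l) (size l + 1) ?r)"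
      by (auto simp: tree.set_map standard_labeling)
  qed
  then show "tree_word (Node l () r) =
     map (\<lambda>x. x + (size l + 1)) (tree_word r) @ tree_word l @ [size l + 1]"
    by (simp add: tree_word_def rl_postfix_map_tree)
qed

lemma length_tree_word [simp]: "length (tree_word T) = size T"
  using standard_labeling(1)[of T] by (metis length_rl_postfix size_shape tree_word_def)

text \<open>Inserting the tree word rebuilds the standard labeling, so
  \<open>rspine_bst_of_word\<close> counts the saillances.\<close>

lemma card_saillances_tree_word: "card (saillances (tree_word T)) = rspine T"
  using rspine_bst_of_word[of "tree_word T"] bst_of_word_rl_postfix[of "standard_labeling T"]
    standard_labeling[of T] by (metis rspine_shape tree_word_def)

text \<open>The tree word is that of \<open>l\<close> followed by the largest letter, which adds one
  fixed position at the end.\<close>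

lemma skeleton_fst_Node_Leaf:
  assumes "l \<noteq> Leaf"
  shows "skeleton_fst (Node l () Leaf) = Suc (skeleton_fst l)"
proof -
  define P where "P T k \<longleftrightarrow> k \<le> size T - 1 \<and>
     (\<forall>i\<in>{size T - k + 1..size T}. tree_word T ! (i - 1) = i)" for T k
  have sk: "skeleton_fst T = (GREATEST k. P T k)" for T
    by (simp add: skeleton_fst_def P_def)
  \<comment> \<open>Because of truncated subtraction, \<open>k \<le> size l - 1\<close> agrees with
    \<open>Suc k \<le> size l\<close> only for nonempty \<open>l\<close>.\<close>
  have pos: "size l \<ge> 1" using assms by (cases l) auto
  have P_Suc: "P (Node l () Leaf) (Suc k) \<longleftrightarrow> P l k" for k
  proof -
    have "{size l - k + 1..Suc (size l)} = insert (Suc (size l)) {size l - k + 1..size l}"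
      by auto
    then show ?thesis
      using pos by (auto simp: P_def tree_word_simps nth_append)
  qed
  have "P l (GREATEST k. P l k)"
    by (rule GreatestI_nat[of "P l" 0 "size l"]) (auto simp: P_def)
  moreover have "k \<le> (GREATEST k. P l k)" if "P l k" for k
    using that by (rule Greatest_le_nat[of _ _ "size l"]) (auto simp: P_def)
  ultimately show ?thesis
    unfolding sk using P_Suc
    by (intro Greatest_equality) (auto, metis Suc_le_mono not0_implies_Suc le0)
qed

text \<open>The tree word ends with the root label, which is not the largest if \<open>r\<close> is
  nonempty; for a single node the bound on \<open>k\<close> is already 0.\<close>

lemma skeleton_fst_0:
  assumes "r = Leaf \<longrightarrow> l = Leaf"
  shows "skeleton_fst (Node l () r) = 0"
  unfolding skeleton_fst_def
proof (rule Greatest_equality)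
  fix k
  let ?T = "Node l () r"
  assume k: "k \<le> size ?T - 1 \<and> (\<forall>i\<in>{size ?T - k + 1..size ?T}. tree_word ?T ! (i - 1) = i)"
  show "k \<le> 0"
  proof (rule ccontr)
    assume "\<not> k \<le> 0"
    then have "size ?T \<in> {size ?T - k + 1..size ?T}" using k by auto
    then have "tree_word ?T ! (size ?T - 1) = size ?T" using k by blast
    then have "size r = 0" by (simp add: tree_word_simps nth_append)
    then show False using \<open>\<not> k \<le> 0\<close> k assms by auto
  qed
qed auto

lemma skeleton_Node_Leaf:
  assumes "l \<noteq> Leaf"
  shows "skeleton (Node l () Leaf) = (Suc (fst (skeleton l)), snd (skeleton l))"
  using assms by (simp add: skeleton_def skeleton_fst_Node_Leaf tree_word_simps)

lemma skeleton_Node: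
  assumes "r = Leaf \<longrightarrow> l = Leaf"
  shows "skeleton (Node l () r) = (0, rspine (Node l () r))"
  using assms card_saillances_tree_word[of "Node l () r"]
  by (simp add: skeleton_def skeleton_fst_0)

lemma skeleton_bst_dtree:
  fixes w :: "'a::linorder list"
  assumes "distinct w"
  shows "skeleton (shape (bst_of_word w)) = skeleton (dtree w)"
  using assms
proof (induction w rule: distinct_max_induct)
  case (Max xs b ys)
  have D: "dtree (xs @ b # ys) = Node (dtree xs) () (dtree ys)"
    using Max.hyps(2) by (rule dtree_append)
  show ?case
  proof (cases "ys = []")
    case True
    have B: "bst_of_word (xs @ b # ys) = Node (bst_of_word xs) b Leaf"
      using Max.hyps(2) True by (simp add: bst_of_word_snoc filter_separated less_imp_le)
    show ?thesis
    proof (cases "xs = []")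
      case False
      then have "size (bst_of_word xs) \<noteq> size Leaf" "size (dtree xs) \<noteq> size Leaf"
        using Max.hyps(1) by (simp_all add: size_dtree)
      then have "bst_of_word xs \<noteq> Leaf" "dtree xs \<noteq> Leaf" by metis+
      then show ?thesis
        using Max.IH(1) unfolding B D shape_simps by (simp add: True skeleton_Node_Leaf)
    qed (unfold B D shape_simps, simp add: True)
  next
    case False
    then obtain zs c where ys: "ys = zs @ [c]" by (meson rev_exhaust)
    let ?l = "bst_of_word (filter (\<lambda>x. x \<le> c) (xs @ b # zs))"
    let ?r = "bst_of_word (filter (\<lambda>x. c < x) (xs @ b # zs))"
    have B: "bst_of_word (xs @ b # ys) = Node ?l c ?r"
      using bst_of_word_snoc[of "xs @ b # zs" c] by (simp only: ys append_assoc append_Cons)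
    \<comment> \<open>The maximum \<open>b\<close> is inserted after the root \<open>c\<close> and
      goes to its right, so this right subtree is nonempty.\<close>
    have "c < b" using Max.hyps(2) ys by simp
    then have "size ?r > 0" by simp
    then have r: "shape ?r \<noteq> Leaf" by (metis size_shape less_irrefl tree.size(3))
    have "size (dtree ys) > 0"
      using Max.hyps(1) False by (simp add: size_dtree)
    then have y: "dtree ys \<noteq> Leaf" by auto
    have "skeleton (dtree (xs @ b # ys)) = (0, rspine (dtree (xs @ b # ys)))"
      unfolding D using y by (intro skeleton_Node) simp
    moreover have "skeleton (shape (bst_of_word (xs @ b # ys))) =
        (0, rspine (shape (bst_of_word (xs @ b # ys))))"
      unfolding B shape_simps using r by (intro skeleton_Node) simp
    ultimately show ?thesis
      using Max.hyps(1) by (simp only: rspine_shape rspine_bst_of_word rspine_dtree)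
  qed
qed simp

lemma linked_skeleton: "linked T U \<Longrightarrow> skeleton T = skeleton U"
  by (auto simp: linked_def skeleton_bst_dtree)

section \<open>Trees with equal skeletons are connected\<close>

abbreviation connected_trees :: "unit tree \<Rightarrow> unit tree \<Rightarrow> bool" where
  "connected_trees \<equiv> linked\<^sup>*\<^sup>*"

lemma connected_trees_sym: "connected_trees T U \<Longrightarrow> connected_trees U T"
  using linked_sym by (metis sympD sympI symp_rtranclp)

lemma connected_trees_size: "connected_trees T U \<Longrightarrow> size T = size U"
  by (induction rule: rtranclp_induct) (auto dest: linked_size)

text \<open>A new largest letter in last place becomes the root of both trees, with the old tree on
  its left.\<close>

lemma linked_Node_Leaf:
  assumes "linked T U"
  shows "linked (Node T () Leaf) (Node U () Leaf)"
proof -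
  obtain w :: "nat list" where w: "distinct w" "T = shape (bst_of_word w)" "U = dtree w"
    using assms by (auto simp: linked_def)
  \<comment> \<open>The \<open>0\<close> covers the empty word.\<close>
  define b where "b = Suc (Max (insert 0 (set w)))"
  have b: "x < b" if "x \<in> set w" for x
    using that by (simp add: b_def le_imp_less_Suc)
  then have "filter (\<lambda>x. x \<le> b) w = w" "filter (\<lambda>x. b < x) w = []"
    by (simp_all add: filter_separated less_imp_le)
  then have "shape (bst_of_word (w @ [b])) = Node T () Leaf" "dtree (w @ [b]) = Node U () Leaf"
    using w b by (simp_all add: bst_of_word_snoc dtree_append)
  moreover have "distinct (w @ [b])" using w b by auto
  ultimately show ?thesis using linkedI by metis
qed

lemma connected_trees_Node_Leaf:
  "connected_trees T U \<Longrightarrow> connected_trees (Node T () Leaf) (Node U () Leaf)"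
  by (induction rule: rtranclp_induct) (auto intro: linked_Node_Leaf rtranclp.rtrancl_into_rtrancl)

section \<open>Right combs and readings with the spine last\<close>

fun right_comb :: "nat \<Rightarrow> unit tree" where
  "right_comb 0 = Leaf"
| "right_comb (Suc k) = Node Leaf () (right_comb k)"

lemma size_right_comb [simp]: "size (right_comb k) = k"
  by (induction k) auto

lemma dtree_decreasing: "sorted_wrt (>) xs \<Longrightarrow> dtree xs = right_comb (length xs)"
proof (induction xs)
  case (Cons a xs)
  then show ?case using dtree_append[of "[]" xs a] by simp
qed simp

lemma dtree_append_decreasing:
  assumes "sorted_wrt (>) (b # s)" "\<And>x. x \<in> set u \<Longrightarrow> x < b"
  shows "dtree (u @ b # s) = Node (dtree u) () (right_comb (length s))"
proof -
  have "dtree (u @ b # s) = Node (dtree u) () (dtree s)"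
    using assms by (intro dtree_append) auto
  then show ?thesis using assms by (simp add: dtree_decreasing)
qed

text \<open>Read from the bottom up, so that the labels of a search tree decrease and the root is
  inserted first.\<close>

fun spine_word :: "'a tree \<Rightarrow> 'a list" where
  "spine_word Leaf = []"
| "spine_word (Node l a r) = spine_word r @ [a]"

fun off_spine_word :: "'a tree \<Rightarrow> 'a list" where
  "off_spine_word Leaf = []"
| "off_spine_word (Node l a r) = rl_postfix l @ off_spine_word r"

lemma set_spine_words: "set (off_spine_word t) \<union> set (spine_word t) = set_tree t"
  by (induction t) auto

lemma length_spine_word [simp]: "length (spine_word t) = rspine t"
  by (induction t) auto

lemma distinct_spine_words: "bst (t :: 'a::linorder tree) \<Longrightarrow> distinct (off_spine_word t @ spine_word t)"
proof (induction t)
  case (Node l a r)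
  then show ?case using set_spine_words[of r] distinct_rl_postfix[of l] by fastforce
qed simp

lemma bst_of_spine_words:
  "bst (t :: 'a::linorder tree) \<Longrightarrow> bst_of_word (off_spine_word t @ spine_word t) = t"
proof (induction t)
  case (Node l a r)
  have s: "\<forall>x\<in>set (off_spine_word r @ spine_word r). a < x"
    using set_spine_words[of r] Node.prems by auto
  have "filter (\<lambda>x. x \<le> a) (rl_postfix l @ off_spine_word r @ spine_word r) = rl_postfix l"
    "filter (\<lambda>x. a < x) (rl_postfix l @ off_spine_word r @ spine_word r)
       = off_spine_word r @ spine_word r"
    using s Node.prems by (simp_all add: filter_separated less_imp_le)
  then show ?case
    using Node bst_of_word_rl_postfix[of l]
      bst_of_word_snoc[of "rl_postfix l @ off_spine_word r @ spine_word r" a] by simp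
qed simp

lemma spine_word_decreasing: "bst (t :: 'a::linorder tree) \<Longrightarrow> sorted_wrt (>) (spine_word t)"
proof (induction t)
  case (Node l a r)
  then show ?case using set_spine_words[of r] by (auto simp: sorted_wrt_append)
qed simp

text \<open>The first spine letter is the lowest spine node, which carries the largest label of the
  tree.\<close>

lemma off_spine_less_hd_spine:
  "bst (t :: 'a::linorder tree) \<Longrightarrow> x \<in> set (off_spine_word t) \<Longrightarrow> x < hd (spine_word t)"
proof (induction t)
  case (Node l a r)
  show ?case
  proof (cases r)
    case Leaf
    then show ?thesis using Node by simp
  next
    case (Node l' a' r')
    then have ne: "spine_word r \<noteq> []" by simp
    then have "hd (spine_word r) \<in> set_tree r"
      using set_spine_words[of r] hd_in_set by fastforce
    then have "a < hd (spine_word r)" using Node.prems by simp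
    then show ?thesis using Node.IH(2) Node.prems ne by fastforce
  qed
qed simp

text \<open>With the spine read last, the search tree is still \<open>T\<close>. In the decreasing
  tree the first spine letter is the root, and the remaining decreasing spine letters form the
  comb.\<close>

lemma linked_right_comb:
  assumes "T \<noteq> Leaf"
  shows "\<exists>U. linked T (Node U () (right_comb (rspine T - 1)))"
proof -
  define t where "t = standard_labeling T"
  have t: "bst t" "shape t = T" by (simp_all add: t_def standard_labeling)
  let ?u = "off_spine_word t"
  have "spine_word t \<noteq> []" using assms t by (cases t) auto
  then obtain b s where bs: "spine_word t = b # s" by (cases "spine_word t") auto
  have "dtree (?u @ b # s) = Node (dtree ?u) () (right_comb (length s))"
    using spine_word_decreasing[OF t(1)] off_spine_less_hd_spine[OF t(1)]
    by (intro dtree_append_decreasing) (simp_all add: bs)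
  moreover have "length s = rspine T - 1"
    using length_spine_word[of t] t(2) rspine_shape[of t] by (simp add: bs)
  moreover have "shape (bst_of_word (?u @ b # s)) = T" "distinct (?u @ b # s)"
    using bst_of_spine_words[OF t(1)] distinct_spine_words[OF t(1)] t(2) by (simp_all add: bs)
  ultimately show ?thesis
    using linkedI[of "?u @ b # s"] by auto
qed

text \<open>The words \<open>u\<close> and \<open>u'\<close>, followed by the same large letters and the cut letter \<open>c\<close>, have the same
  binary search tree, since insertion after \<open>c\<close> separates the letters on the two sides of \<open>c\<close>.\<close>

lemma connected_cut:
  fixes u u' :: "nat list"
  assumes "distinct u" "distinct u'" "c \<notin> set u" "c \<notin> set u'"
    and "filter (\<lambda>x. x \<le> c) u = filter (\<lambda>x. x \<le> c) u'"
    and "filter (\<lambda>x. c < x) u = filter (\<lambda>x. c < x) u'"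
  shows "connected_trees (Node (dtree u) () (right_comb (Suc j))) (Node (dtree u') () (right_comb (Suc j)))"
proof -
  define B where "B = Suc (Max (insert c (set u \<union> set u')))"
  have B: "x < B" if "x = c \<or> x \<in> set u \<or> x \<in> set u'" for x
    unfolding B_def using that by (intro le_imp_less_Suc Max_ge) auto
  \<comment> \<open>These \<open>j + 1\<close> large letters and \<open>c\<close> decrease; after
    the first, which is the maximum, \<open>j + 1\<close> letters remain for the comb.\<close>
  let ?s = "rev [B..<Suc (B + j)]"
  have "\<exists>s. ?s = (B + j) # s \<and> length s = j" by simp
  then obtain s where s: "?s = (B + j) # s" "length s = j" by blast
  have "sorted_wrt (>) ?s"
    by (simp only: sorted_wrt_rev sorted_wrt_upt)
  moreover have "\<forall>x\<in>set ?s. c < x"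
    using B[of c] by (simp only: set_rev set_upt) auto
  ultimately have dec: "sorted_wrt (>) ((B + j) # s @ [c])"
    unfolding s(1) by (auto simp: sorted_wrt_append)
  have *: "linked (shape (bst_of_word (v @ ?s @ [c]))) (Node (dtree v) () (right_comb (Suc j)))"
    if v: "distinct v" "c \<notin> set v" "\<And>x. x \<in> set v \<Longrightarrow> x < B" for v
  proof -
    have "distinct (v @ ?s @ [c])"
      using v B[of c] by (auto dest: v(3))
    moreover have "dtree (v @ ?s @ [c]) = Node (dtree v) () (right_comb (Suc j))"
      using dtree_append_decreasing[OF dec, of v] trans_less_add1[OF v(3)] s by (simp del: upt_Suc)
    ultimately show ?thesis using linkedI by metis
  qed
  have "bst_of_word (u @ ?s @ [c]) = bst_of_word (u' @ ?s @ [c])"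
    using assms by (intro bst_of_word_append_cong)
  then show ?thesis
    using *[of u] *[of u'] assms B linked_sym by (metis converse_rtranclp_into_rtranclp r_into_rtranclp)
qed

section \<open>Sorting by adjacent exchanges\<close>

lemma adjacent_swaps_sort:
  assumes refl: "\<And>u. R u u" and trans: "\<And>u v w. R u v \<Longrightarrow> R v w \<Longrightarrow> R u w"
    and swap: "\<And>p a b q. distinct (p @ a # b # q) \<Longrightarrow> set (p @ a # b # q) \<subseteq> S \<Longrightarrow>
                 R (p @ a # b # q) (p @ b # a # q)"
    and "distinct u" "set u \<subseteq> S"
  shows "R u (sort u)"
proof -
  \<comment> \<open>Insertion sort moves \<open>x\<close> to the right by exchanges of neighbours;
    \<open>p\<close> holds the letters to the left.\<close>
  have insort: "R (p @ x # v) (p @ insort x v)"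
    if "distinct (p @ x # v)" "set (p @ x # v) \<subseteq> S" for p x v
    using that
  proof (induction v arbitrary: p)
    case (Cons y v)
    have "R (p @ x # y # v) (p @ y # x # v)" using Cons.prems by (rule swap)
    moreover have "R ((p @ [y]) @ x # v) ((p @ [y]) @ insort x v)"
      using Cons.prems by (intro Cons.IH) auto
    ultimately show ?case using refl trans by auto
  qed (simp add: refl)
  have "R (p @ u) (p @ sort u)" if "distinct (p @ u)" "set (p @ u) \<subseteq> S" for p
    using that
  proof (induction u arbitrary: p)
    case (Cons x u)
    have "R ((p @ [x]) @ u) ((p @ [x]) @ sort u)"
      using Cons.prems by (intro Cons.IH) auto
    moreover have "R (p @ x # sort u) (p @ insort x (sort u))"
      using Cons.prems by (intro insort) auto
    ultimately show ?case using trans by auto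
  qed (simp add: refl)
  from this[of "[]"] show ?thesis using assms by simp
qed

text \<open>The postfix reading makes \<open>T\<close> a search tree, and symmetry of
  \<open>linked\<close> makes it a decreasing tree. Doubling the letters leaves an odd number
  between any two of them.\<close>

lemma ex_dtree_even:
  obtains u where "distinct u" "set u = (*) 2 ` {1..size T}" "dtree u = T"
proof -
  let ?w = "rl_postfix (standard_labeling T)"
  have "linked T (dtree ?w)"
    using linkedI[of ?w] standard_labeling[of T]
    by (simp add: distinct_rl_postfix bst_of_word_rl_postfix)
  then have "linked (dtree ?w) T" by (rule linked_sym)
  then have "M (size T) (dtree ?w) T \<noteq> 0"
    using linked_size[of "dtree ?w" T] by (simp only: M_nonzero_iff_linked)
  then obtain w where w: "distinct w" "set w = {1..size T}" "T = dtree w"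
    by (auto simp only: M_nonzero_iff_word)
  have "dtree (map ((*) 2) w) = T"
    using w by (simp add: dtree_map strict_mono_on_def)
  moreover have "distinct (map ((*) 2) w)" using w by (simp add: distinct_map inj_on_def)
  ultimately show ?thesis using that[of "map ((*) 2) w"] w by simp
qed

text \<open>\<open>Suc j\<close> guarantees a place after the maximum for the cut letter of
  \<open>connected_cut\<close>.\<close>

lemma connected_right_comb:
  assumes "size U = size V"
  shows "connected_trees (Node U () (right_comb (Suc j))) (Node V () (right_comb (Suc j)))"
proof -
  define S where "S = (*) 2 ` {1..size U}"
  let ?X = "\<lambda>u :: nat list. Node (dtree u) () (right_comb (Suc j))"
  have sort: "connected_trees (?X u) (?X (sort u))" if u: "distinct u" "set u = S" for u
  proof (rule adjacent_swaps_sort[where S = S])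
    fix p q :: "nat list" and a b
    assume d: "distinct (p @ a # b # q)" and S: "set (p @ a # b # q) \<subseteq> S"
    \<comment> \<open>Both letters are even, so this number is odd, hence new, and lies strictly
      between them.\<close>
    define c where "c = Suc (min a b)"
    have ev: "even x" if "x \<in> S" for x using that by (auto simp: S_def)
    have "odd c" using S ev[of a] ev[of b] by (simp add: c_def min_def)
    then have "c \<notin> set (p @ a # b # q)" using S ev by blast
    moreover have "a \<noteq> b" using d by simp
    then have "a \<le> c \<longleftrightarrow> \<not> b \<le> c"
      using calculation by (auto simp: c_def min_def split: if_splits)
    ultimately show "connected_trees (?X (p @ a # b # q)) (?X (p @ b # a # q))"
      using d by (intro connected_cut[of _ _ c]) auto
  qed (use u in auto)
  obtain u where u: "distinct u" "set u = S" "dtree u = U"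
    unfolding S_def by (rule ex_dtree_even)
  obtain v where v: "distinct v" "set v = S" "dtree v = V"
    unfolding S_def assms by (rule ex_dtree_even)
  \<comment> \<open>Both words use exactly the letters of \<open>S\<close>, so they meet in the same
    increasing word.\<close>
  have "sort u = sort v"
    using u v by (metis sorted_list_of_set_sort_remdups distinct_remdups_id)
  then show ?thesis
    using sort[OF u(1,2)] connected_trees_sym[OF sort[OF v(1,2)]] u(3) v(3) by auto
qed

lemma connected_if_skeleton_eq:
  assumes "size T = size U" "skeleton T = skeleton U"
  shows "connected_trees T U"
  using assms
proof (induction T arbitrary: U)
  case Leaf
  then show ?case by simp
next
  case (Node l x r)
  from Node.prems(1) obtain l' r' where U: "U = Node l' () r'"
    by (cases U) auto
  have [simp]: "x = ()" by simp
  \<comment> \<open>The first component of a skeleton is positive exactly for a root with a left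
    child only.\<close>
  have iff: "r = Leaf \<and> l \<noteq> Leaf \<longleftrightarrow> r' = Leaf \<and> l' \<noteq> Leaf"
    using Node.prems(2) by (metis U \<open>x = ()\<close> skeleton_Node skeleton_Node_Leaf fst_conv nat.distinct(1))
  consider "r = Leaf" "l \<noteq> Leaf" | "r = Leaf" "l = Leaf" | "r \<noteq> Leaf" by blast
  then show ?case
  proof cases
    case 1
    then have "r' = Leaf" "l' \<noteq> Leaf" using iff by auto
    then have "skeleton l = skeleton l'" "size l = size l'"
      using Node.prems 1 by (auto simp: U skeleton_Node_Leaf prod_eq_iff)
    then show ?thesis
      using Node.IH(1) connected_trees_Node_Leaf \<open>r' = Leaf\<close> 1 by (simp add: U)
  next
    case 2
    then show ?thesis using Node.prems by (auto simp: U)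
  next
    case 3
    then have r': "r' = Leaf \<longrightarrow> l' = Leaf" using iff by blast
    have spine: "rspine (Node l x r) = rspine U"
      using Node.prems(2) 3 r' by (simp add: U skeleton_Node)
    \<comment> \<open>A nonempty right subtree gives a spine of at least two nodes, hence a nonempty
      comb.\<close>
    obtain j where j: "rspine (Node l x r) - 1 = Suc j" using 3 by (cases r) auto
    obtain V where V: "linked (Node l x r) (Node V () (right_comb (Suc j)))"
      using linked_right_comb[of "Node l x r"] unfolding j by blast
    obtain W where W: "linked U (Node W () (right_comb (Suc j)))"
      using linked_right_comb[of U] U unfolding spine[symmetric] j by blast
    have "size V = size W"
      using linked_size[OF V] linked_size[OF W] Node.prems(1) by simp
    then have "connected_trees (Node V () (right_comb (Suc j))) (Node W () (right_comb (Suc j)))"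
      by (rule connected_right_comb)
    then show ?thesis
      using V linked_sym[OF W]
      by (meson converse_rtranclp_into_rtranclp rtranclp.rtrancl_into_rtrancl)
  qed
qed

section \<open>Blocks\<close>

text \<open>Entries are natural numbers, so the terms of the sum cannot cancel.\<close>

lemma matrix_power_Suc_nonzero_iff:
  fixes A :: "'i \<Rightarrow> 'i \<Rightarrow> nat"
  assumes "finite I"
  shows "matrix_power I A (Suc k) x y \<noteq> 0 \<longleftrightarrow> (\<exists>z\<in>I. matrix_power I A k x z \<noteq> 0 \<and> A z y \<noteq> 0)"
  using assms by simp

lemma skeleton_eq_if_matrix_power_nonzero:
  "matrix_power (trees n) (M n) k T U \<noteq> 0 \<Longrightarrow> skeleton T = skeleton U"
proof (induction k arbitrary: U)
  case (Suc k)
  then obtain V where "matrix_power (trees n) (M n) k T V \<noteq> 0" "M n V U \<noteq> 0"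
    by (auto simp only: matrix_power_Suc_nonzero_iff[OF finite_trees])
  then show ?case
    using Suc.IH linked_skeleton by (metis M_nonzero_iff_linked)
qed (simp split: if_splits)

text \<open>The exponent is the number of links in the path, possibly 0.\<close>

lemma matrix_power_nonzero_if_connected:
  assumes "connected_trees T U" "size T = n"
  shows "\<exists>k. matrix_power (trees n) (M n) k T U \<noteq> 0"
  using assms(1)
proof (induction rule: rtranclp_induct)
  case base
  have "matrix_power (trees n) (M n) 0 T T \<noteq> 0" by simp
  then show ?case by blast
next
  case (step U V)
  then have "size U = n" using connected_trees_size[OF step.hyps(1)] assms(2) by simp
  then have "U \<in> trees n" "M n U V \<noteq> 0"
    using step.hyps(2) by (auto simp only: trees_def M_nonzero_iff_linked)
  then show ?case
    using step.IH matrix_power_Suc_nonzero_iff[OF finite_trees] by blast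
qed

theorem mainTheorem18:
  fixes n :: nat and T U :: "unit tree"
  assumes "n \<ge> 1" and "T \<in> trees n" and "U \<in> trees n"
  shows "same_block n T U \<longleftrightarrow> size T = size U \<and> skeleton T = skeleton U"
proof
  assume "same_block n T U"
  then show "size T = size U \<and> skeleton T = skeleton U"
    using assms skeleton_eq_if_matrix_power_nonzero by (auto simp: same_block_def trees_def)
next
  assume "size T = size U \<and> skeleton T = skeleton U"
  then have conn: "connected_trees T U" by (intro connected_if_skeleton_eq) auto
  have size: "size T = n" "size U = n" using assms by (auto simp: trees_def)
  obtain V where "linked U V"
    using linked_right_comb[of U] size assms(1) by (metis not_one_le_zero tree.size(3))
  \<comment> \<open>One step back along the path guarantees a positive exponent.\<close>
  then have V: "linked V U" by (rule linked_sym)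
  then have "size V = n" using linked_size size by simp
  have "connected_trees T V"
    using conn \<open>linked U V\<close> by (rule rtranclp.rtrancl_into_rtrancl)
  then obtain k where "matrix_power (trees n) (M n) k T V \<noteq> 0"
    using matrix_power_nonzero_if_connected size by blast
  moreover have "M n V U \<noteq> 0" "V \<in> trees n"
    using V \<open>size V = n\<close> by (auto simp only: M_nonzero_iff_linked trees_def)
  ultimately have "matrix_power (trees n) (M n) (Suc k) T U \<noteq> 0"
    using matrix_power_Suc_nonzero_iff[OF finite_trees] by blast
  then show "same_block n T U"
    unfolding same_block_def by (metis le_add1 plus_1_eq_Suc)
qed

end
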